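(* For any plane graph $G$, any edge $e^*$ of $G$, and any assignment of lists of size $9$ to the edges of $G$, there exists a partial edge-coloring of $G$ in which every edge other than $e^*$ receives a color from its list, $e^*$ is uncolored, and no facial path of colored edges is a repetition.
   Context: A plane graph is a planar graph with a fixed embedding in the plane. A facial edge-path is a path whose edges are consecutive edges on the boundary walk of some face. An edge path $e_1,\dots,e_{2j}$ ($j\ge 1$) is a repetition if $c(e_i)=c(e_{i+j})$ for all $1\le i\le j$. A (partial) edge-coloring is a facial Thue edge-coloring if no facial path of colored edges is a repetition. *)

theory Defs
  imports Main "HOL-Combinatorics.Permutations"
begin

(* A plane graph is encoded by a combinatorial map (rotation system):
   a finite dart set D, a fixed-point-free involution alpha (the two darts
   of an edge) and a permutation sigma (the cyclic order of darts around
   each vertex). Faces are orbits of phi = sigma o alpha. *)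

definition orb :: "('d \<Rightarrow> 'd) \<Rightarrow> 'd \<Rightarrow> 'd set" where
  "orb f d = {(f ^^ n) d | n. True}"

definition phi :: "('d \<Rightarrow> 'd) \<Rightarrow> ('d \<Rightarrow> 'd) \<Rightarrow> 'd \<Rightarrow> 'd" where
  "phi alpha sigma = sigma \<circ> alpha"

definition map_vertices :: "'d set \<Rightarrow> ('d \<Rightarrow> 'd) \<Rightarrow> 'd set set" where
  "map_vertices D sigma = orb sigma ` D"

definition edge_of :: "('d \<Rightarrow> 'd) \<Rightarrow> 'd \<Rightarrow> 'd set" where
  "edge_of alpha d = {d, alpha d}"

definition map_edges :: "'d set \<Rightarrow> ('d \<Rightarrow> 'd) \<Rightarrow> 'd set set" where
  "map_edges D alpha = edge_of alpha ` D"

definition map_faces :: "'d set \<Rightarrow> ('d \<Rightarrow> 'd) \<Rightarrow> ('d \<Rightarrow> 'd) \<Rightarrow> 'd set set" where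
  "map_faces D alpha sigma = orb (phi alpha sigma) ` D"

definition map_components :: "'d set \<Rightarrow> ('d \<Rightarrow> 'd) \<Rightarrow> ('d \<Rightarrow> 'd) \<Rightarrow> 'd set set" where
  "map_components D alpha sigma =
     (\<lambda>d. {d'. (d, d') \<in> ({(x, alpha x) | x. x \<in> D} \<union> {(x, sigma x) | x. x \<in> D})\<^sup>*}) ` D"

(* combinatorial map of a simple plane graph: every connected component has
   Euler characteristic 2 (genus 0), no loops, no parallel edges *)
definition simple_plane_map :: "'d set \<Rightarrow> ('d \<Rightarrow> 'd) \<Rightarrow> ('d \<Rightarrow> 'd) \<Rightarrow> bool" where
  "simple_plane_map D alpha sigma \<longleftrightarrow>
     finite D \<and> alpha permutes D \<and> sigma permutes D \<and>
     (\<forall>d\<in>D. alpha (alpha d) = d \<and> alpha d \<noteq> d) \<and>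
     card (map_vertices D sigma) + card (map_faces D alpha sigma)
       = card (map_edges D alpha) + 2 * card (map_components D alpha sigma) \<and>
     (\<forall>d\<in>D. alpha d \<notin> orb sigma d) \<and>
     (\<forall>d\<in>D. \<forall>d'\<in>D. orb sigma d = orb sigma d' \<and> orb sigma (alpha d) = orb sigma (alpha d')
        \<longrightarrow> d = d')"

(* The k consecutive edges of darts d, phi d, ..., phi^(k-1) d along a facial
   walk form a facial path: the traversed vertices v_0, ..., v_k are distinct. *)
definition facial_path :: "'d set \<Rightarrow> ('d \<Rightarrow> 'd) \<Rightarrow> ('d \<Rightarrow> 'd) \<Rightarrow> 'd \<Rightarrow> nat \<Rightarrow> bool" where
  "facial_path D alpha sigma d k \<longleftrightarrow>
     d \<in> D \<and> k \<ge> 1 \<and> inj_on (\<lambda>i. orb sigma ((phi alpha sigma ^^ i) d)) {0..k}"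

definition path_edge :: "('d \<Rightarrow> 'd) \<Rightarrow> ('d \<Rightarrow> 'd) \<Rightarrow> 'd \<Rightarrow> nat \<Rightarrow> 'd set" where
  "path_edge alpha sigma d i = edge_of alpha ((phi alpha sigma ^^ i) d)"

definition facial_thue :: "'d set \<Rightarrow> ('d \<Rightarrow> 'd) \<Rightarrow> ('d \<Rightarrow> 'd) \<Rightarrow> ('d set \<Rightarrow> 'c option) \<Rightarrow> bool" where
  "facial_thue D alpha sigma c \<longleftrightarrow>
     (\<forall>d j. j \<ge> 1 \<and> facial_path D alpha sigma d (2 * j) \<and>
        (\<forall>i < 2 * j. c (path_edge alpha sigma d i) \<noteq> None) \<longrightarrow>
        \<not> (\<forall>i < j. c (path_edge alpha sigma d i) = c (path_edge alpha sigma d (i + j))))"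

end

theory Submission
  imports Defs Complex_Main "HOL-Library.FuncSet"
begin

text \<open>
  Rosenfeld's counting argument. Let \<open>col S\<close> be the set of repetition-free list colourings of an
  edge set \<open>S\<close>. If \<open>e \<notin> S\<close> is consecutive on some face to an edge outside \<open>insert e S\<close>, then
  \<open>card (col (insert e S)) \<ge> 3 * card (col S)\<close>: at most \<open>2 j + 1\<close> facial paths of length \<open>2 j\<close> in
  \<open>insert e S\<close> contain \<open>e\<close>, by induction each of them spoils at most \<open>card (col S) / 3 ^ (j - 1)\<close>
  extensions, and \<open>9 - (\<Sum>j\<ge>1. (2 j + 1) / 3 ^ (j - 1)) = 3\<close>.
  For an arbitrary edge \<open>e\<close> there are at most \<open>4 j\<close> such paths, and since
  \<open>(\<Sum>j\<ge>1. 4 j / 3 ^ (j - 1)) = 9\<close>, every finite partial sum leaves an admissible extension.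
\<close>

text \<open>The cases used are \<open>p = 2\<close>, \<open>q = 1\<close> and \<open>p = 4\<close>,
  \<open>q = 0\<close>, with limits 6 and 9. The explicit subtracted term shows that every partial
  sum stays below its limit.\<close>

lemma sum_arith_geom:
  fixes p q :: real
  shows "(\<Sum>j=1..n. (p * j + q) / 3 ^ (j - 1)) =
    9 / 4 * p + 3 / 2 * q - (p * (6 * real n + 9) + 6 * q) / (4 * 3 ^ n)"
proof (induction n)
  case (Suc n)
  then have "(\<Sum>j=1..Suc n. (p * j + q) / 3 ^ (j - 1)) =
      9 / 4 * p + 3 / 2 * q - (p * (6 * real n + 9) + 6 * q) / (4 * 3 ^ n) + (p * Suc n + q) / 3 ^ n"
    by simp
  also have "\<dots> = 9 / 4 * p + 3 / 2 * q - (p * (6 * real (Suc n) + 9) + 6 * q) / (4 * 3 ^ Suc n)"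
    by (simp add: field_simps)
  finally show ?case .
qed simp

section \<open>Walks of darts and repetition-free colourings\<close>

text \<open>Darts walk along faces by \<open>f\<close>, \<open>ed\<close> projects them to edges,
  and \<open>P x k\<close> stands for a facial path of \<open>k\<close> edges starting with the dart
  \<open>x\<close>. \<open>fibre\<close> reflects the two sides of an edge and is what bounds the
  number of paths through it.\<close>

locale facial_walks =
  fixes D :: "'d set" and f :: "'d \<Rightarrow> 'd" and ed :: "'d \<Rightarrow> 'e"
    and P :: "'d \<Rightarrow> nat \<Rightarrow> bool" and L :: "'e \<Rightarrow> 'c set"
  assumes fin_D: "finite D"
    and perm: "f permutes D"
    and fibre: "card {x \<in> D. ed x = e} \<le> 2"
    and path_D: "P x k \<Longrightarrow> x \<in> D"
    and path_inj: "P x k \<Longrightarrow> inj_on (\<lambda>i. ed ((f ^^ i) x)) {..<k}"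
    and lists: "x \<in> D \<Longrightarrow> finite (L (ed x)) \<and> card (L (ed x)) = 9"
begin

definition w :: "'d \<Rightarrow> nat \<Rightarrow> 'e" where
  "w x i = ed ((f ^^ i) x)"

definition rep :: "('e \<Rightarrow> 'c) \<Rightarrow> 'd \<Rightarrow> nat \<Rightarrow> bool" where
  "rep c x j \<longleftrightarrow> (\<forall>i<j. c (w x i) = c (w x (i + j)))"

text \<open>Membership in \<open>PiE\<close> makes colourings extensional, so that each one is
  counted once. The bound \<open>1 \<le> j\<close> excludes the vacuous
  \<open>rep c x 0\<close>.\<close>

definition col :: "'e set \<Rightarrow> ('e \<Rightarrow> 'c) set" where
  "col S = {c \<in> PiE S L. \<forall>x j. 1 \<le> j \<and> P x (2 * j) \<and> w x ` {..<2 * j} \<subseteq> S \<longrightarrow> \<not> rep c x j}"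

text \<open>For \<open>e\<close> outside \<open>S\<close>, these are the paths that become fully
  coloured only when \<open>e\<close> is added, recorded by their starting darts.\<close>

definition through :: "'e \<Rightarrow> 'e set \<Rightarrow> nat \<Rightarrow> 'd set" where
  "through e S j = {x. P x (2 * j) \<and> w x ` {..<2 * j} \<subseteq> insert e S \<and> e \<in> w x ` {..<2 * j}}"

definition adj :: "'e \<Rightarrow> 'e \<Rightarrow> bool" where
  "adj e g \<longleftrightarrow> (\<exists>x\<in>D. ed x = e \<and> ed (f x) = g \<or> ed x = g \<and> ed (f x) = e)"

lemma w_inj: "P x k \<Longrightarrow> inj_on (w x) {..<k}"
  using path_inj[of x k] by (simp add: w_def[abs_def])

lemma iter_in: "x \<in> D \<Longrightarrow> (f ^^ i) x \<in> D"
  by (induction i) (simp_all add: permutes_in_image[OF perm])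

lemma iter_inj: "(f ^^ i) x = (f ^^ i) y \<Longrightarrow> x = y"
  using permutes_inj[OF perm] by (induction i) (auto dest: injD)

lemma adj_w: "x \<in> D \<Longrightarrow> adj (w x i) (w x (Suc i))"
  "x \<in> D \<Longrightarrow> adj (w x (Suc i)) (w x i)"
  unfolding adj_def w_def using iter_in[of x i] by auto

lemma fin_edges: "S \<subseteq> ed ` D \<Longrightarrow> finite S"
  using fin_D finite_surj by blast

lemma finite_PiE_L: "S \<subseteq> ed ` D \<Longrightarrow> finite (PiE S L)"
  using lists by (intro finite_PiE fin_edges) auto

lemma finite_col: "S \<subseteq> ed ` D \<Longrightarrow> finite (col S)"
  using finite_PiE_L by (auto simp: col_def)

lemma rep_cong: "w x ` {..<2 * j} \<subseteq> S \<Longrightarrow> rep (restrict c S) x j = rep c x j"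
proof -
  assume "w x ` {..<2 * j} \<subseteq> S"
  then have "w x i \<in> S \<and> w x (i + j) \<in> S" if "i < j" for i
    using that by (auto simp: image_subset_iff)
  then show ?thesis by (auto simp: rep_def)
qed

lemma restrict_col:
  assumes "c \<in> col S" "T \<subseteq> S"
  shows "restrict c T \<in> col T"
proof -
  have "restrict c T \<in> PiE T L" using assms by (auto simp: col_def)
  moreover have "\<not> rep (restrict c T) x j"
    if "1 \<le> j" "P x (2 * j)" "w x ` {..<2 * j} \<subseteq> T" for x j
    using assms that rep_cong[OF that(3), of c] by (force simp: col_def)
  ultimately show ?thesis by (auto simp: col_def)
qed

section \<open>Counting the extensions by one edge\<close>

lemma card_extensions:
  assumes "insert e S \<subseteq> ed ` D" "e \<notin> S"
  shows "card {c \<in> PiE (insert e S) L. restrict c S \<in> col S} = 9 * card (col S)"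
proof -
  let ?X = "{c \<in> PiE (insert e S) L. restrict c S \<in> col S}"
  have "bij_betw (\<lambda>(y, c). c(e := y)) (L e \<times> col S) ?X"
  proof (rule bij_betw_byWitness[where f' = "\<lambda>c. (c e, restrict c S)"])
    show "\<forall>a\<in>L e \<times> col S. (\<lambda>c. (c e, restrict c S)) (case a of (y, c) \<Rightarrow> c(e := y)) = a"
      using assms(2) by (auto simp: col_def fun_eq_iff PiE_def extensional_def)
    show "\<forall>c\<in>?X. (case (c e, restrict c S) of (y, c) \<Rightarrow> c(e := y)) = c"
      by (auto simp: fun_eq_iff PiE_def extensional_def)
    have "restrict (c(e := y)) S = c" if "c \<in> col S" for c y
      using that assms(2) by (auto simp: col_def fun_eq_iff PiE_def extensional_def)
    then show "(\<lambda>(y, c). c(e := y)) ` (L e \<times> col S) \<subseteq> ?X"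
      by (auto simp: col_def intro!: PiE_fun_upd)
    show "(\<lambda>c. (c e, restrict c S)) ` ?X \<subseteq> L e \<times> col S" by auto
  qed
  from bij_betw_same_card[OF this] have "card ?X = card (L e) * card (col S)"
    by (simp add: card_cartesian_product)
  moreover have "card (L e) = 9" using assms(1) lists by auto
  ultimately show ?thesis by simp
qed

text \<open>A repetition is determined by the colours outside the half that contains \<open>e\<close>.\<close>

lemma card_bad:
  assumes S: "insert e S \<subseteq> ed ` D" and e: "e \<notin> S" and x: "x \<in> through e S j"
  obtains a where "a + j \<le> 2 * j" "e \<in> w x ` {a..<a + j}"
    "card {c \<in> PiE (insert e S) L. restrict c S \<in> col S \<and> rep c x j}
       \<le> card (col (S - w x ` {a..<a + j}))"
proof -
  obtain t where t: "t < 2 * j" "w x t = e" and P: "P x (2 * j)"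
    and sub: "w x ` {..<2 * j} \<subseteq> insert e S"
    using x by (auto simp: through_def)
  have inj: "w x i = w x k \<longleftrightarrow> i = k" if "i < 2 * j" "k < 2 * j" for i k
    using w_inj[OF P] that by (auto dest: inj_onD)
  define a where "a = (if t < j then 0 else j)"
  have a: "a + j \<le> 2 * j" "t \<in> {a..<a + j}" using t by (auto simp: a_def)
  let ?H = "w x ` {a..<a + j}"
  let ?B = "{c \<in> PiE (insert e S) L. restrict c S \<in> col S \<and> rep c x j}"
  have "inj_on (\<lambda>c. restrict c (S - ?H)) ?B"
  proof (rule inj_onI)
    fix c c'
    assume c: "c \<in> ?B" "c' \<in> ?B" and eq: "restrict c (S - ?H) = restrict c' (S - ?H)"
    have out: "c z = c' z" if "z \<in> S - ?H" for z
      using fun_cong[OF eq, of z] that by simp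
    have "c (w x i) = c' (w x i)" if i: "i \<in> {a..<a + j}" for i
    proof -
      \<comment> \<open>\<open>k\<close> is the position matched with \<open>i\<close> in the other
        half. Its edge is neither in \<open>?H\<close> nor equal to \<open>e\<close>, so both
        colourings agree there.\<close>
      define k where "k = (if t < j then i + j else i - j)"
      have k: "k < 2 * j" "k \<notin> {a..<a + j}" using i by (auto simp: k_def a_def split: if_splits)
      have "w x k \<notin> ?H"
      proof
        assume "w x k \<in> ?H"
        then obtain m where "m \<in> {a..<a + j}" "w x k = w x m" by auto
        with inj[of k m] k a(1) show False by auto
      qed
      moreover have "w x k \<noteq> e" using inj[of k t] k t a(2) by auto
      then have "w x k \<in> S" using sub k(1) by auto
      ultimately have "c (w x k) = c' (w x k)" using out by blast
      moreover have "c (w x i) = c (w x k) \<and> c' (w x i) = c' (w x k)"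
      proof -
        have "rep c x j" "rep c' x j" using c by auto
        note rep = this[unfolded rep_def, rule_format]
        show ?thesis
        proof (cases "t < j")
          case True
          then show ?thesis using rep[of i] i by (simp add: k_def a_def)
        next
          case False
          then have "i - j < j" "i - j + j = i" using i by (auto simp: a_def)
          then show ?thesis using rep[of "i - j"] False by (simp add: k_def)
        qed
      qed
      ultimately show ?thesis by simp
    qed
    then have "c z = c' z" if "z \<in> insert e S" for z
      using out[of z] that a(2) t(2) by (cases "z \<in> ?H") auto
    then show "c = c'" using c by (intro PiE_ext[of c "insert e S" L c']) auto
  qed
  moreover have "(\<lambda>c. restrict c (S - ?H)) ` ?B \<subseteq> col (S - ?H)"
  proof safe
    fix c assume "restrict c S \<in> col S"
    from restrict_col[OF this, of "S - ?H"]
    show "restrict c (S - ?H) \<in> col (S - ?H)" by (simp add: Int_absorb1)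
  qed
  ultimately have "card ?B \<le> card (col (S - ?H))"
    using S by (intro card_inj_on_le finite_col) auto
  then show ?thesis using a t(2) that by blast
qed

text \<open>The \<open>2 * j\<close> edges of a path are distinct and lie in
  \<open>insert e S\<close>. This makes the range of \<open>j\<close> in the count finite.\<close>

lemma through_length_bound:
  assumes "insert e S \<subseteq> ed ` D" "x \<in> through e S j"
  shows "j \<le> Suc (card S)"
proof -
  have "card (w x ` {..<2 * j}) = 2 * j"
    using assms(2) w_inj by (simp add: through_def card_image)
  moreover have "card (w x ` {..<2 * j}) \<le> card (insert e S)"
    using assms fin_edges by (intro card_mono) (auto simp: through_def)
  moreover have "card (insert e S) \<le> Suc (card S)"
    by (simp add: card_insert_le_m1 card_insert_if)
  ultimately show ?thesis by linarith
qed

lemma finite_through: "finite (through e S j)"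
  using fin_D by (rule finite_subset[rotated]) (auto simp: through_def path_D)

text \<open>\<open>N j\<close> bounds the number of facial paths of length \<open>2 j\<close> through \<open>e\<close>; the growth hypothesis
  charges each of them at most \<open>card (col S) / 3 ^ (j - 1)\<close> colourings.\<close>

lemma extension_count:
  fixes N :: "nat \<Rightarrow> real"
  assumes S: "insert e S \<subseteq> ed ` D" and e: "e \<notin> S"
    and growth: "\<And>x j a. x \<in> through e S j \<Longrightarrow> a + j \<le> 2 * j \<Longrightarrow> e \<in> w x ` {a..<a + j} \<Longrightarrow>
      3 ^ (j - 1) * card (col (S - w x ` {a..<a + j})) \<le> card (col S)"
    and N: "\<And>j. 1 \<le> j \<Longrightarrow> card (through e S j) \<le> N j"
  shows "9 * card (col S) \<le>
    card (col (insert e S)) + (\<Sum>j=1..Suc (card S). N j / 3 ^ (j - 1)) * card (col S)"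
proof -
  let ?X = "{c \<in> PiE (insert e S) L. restrict c S \<in> col S}"
  let ?B = "\<lambda>x j. {c \<in> PiE (insert e S) L. restrict c S \<in> col S \<and> rep c x j}"
  let ?J = "{1..Suc (card S)}"
  have fin: "finite (PiE (insert e S) L)" using finite_PiE_L S by blast
  \<comment> \<open>The restriction to \<open>S\<close> has no repetition, so a repetition in an
    extension must use \<open>e\<close>.\<close>
  have "?X \<subseteq> col (insert e S) \<union> (\<Union>j\<in>?J. \<Union>x\<in>through e S j. ?B x j)"
  proof
    fix c assume c: "c \<in> ?X"
    show "c \<in> col (insert e S) \<union> (\<Union>j\<in>?J. \<Union>x\<in>through e S j. ?B x j)"
    proof (cases "c \<in> col (insert e S)")
      case False
      then obtain x j where xj: "1 \<le> j" "P x (2 * j)" "w x ` {..<2 * j} \<subseteq> insert e S" "rep c x j"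
        using c by (auto simp: col_def)
      have "\<not> w x ` {..<2 * j} \<subseteq> S"
      proof
        assume "w x ` {..<2 * j} \<subseteq> S"
        then show False using c xj rep_cong[of x j S c] by (auto simp: col_def)
      qed
      then have "x \<in> through e S j" using xj by (auto simp: through_def)
      then show ?thesis using through_length_bound[OF S, of x j] c xj by auto
    qed simp
  qed
  then have "card ?X \<le> card (col (insert e S) \<union> (\<Union>j\<in>?J. \<Union>x\<in>through e S j. ?B x j))"
    using fin S finite_through by (intro card_mono finite_UnI finite_col finite_UN_I) auto
  also have "\<dots> \<le> card (col (insert e S)) + card (\<Union>j\<in>?J. \<Union>x\<in>through e S j. ?B x j)"
    by (rule card_Un_le)
  also have "card (\<Union>j\<in>?J. \<Union>x\<in>through e S j. ?B x j)
      \<le> (\<Sum>j\<in>?J. card (\<Union>x\<in>through e S j. ?B x j))"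
    by (rule card_UN_le) simp
  also have "\<dots> \<le> (\<Sum>j\<in>?J. \<Sum>x\<in>through e S j. card (?B x j))"
    by (intro sum_mono card_UN_le finite_through)
  finally have le: "card ?X \<le> card (col (insert e S)) + (\<Sum>j\<in>?J. \<Sum>x\<in>through e S j. card (?B x j))"
    by simp
  have B: "real (card (?B x j)) \<le> card (col S) / 3 ^ (j - 1)" if x: "x \<in> through e S j" for x j
  proof -
    obtain a where a: "a + j \<le> 2 * j" "e \<in> w x ` {a..<a + j}"
      "card (?B x j) \<le> card (col (S - w x ` {a..<a + j}))"
      using card_bad[OF S e x] by blast
    have "3 ^ (j - 1) * card (?B x j) \<le> 3 ^ (j - 1) * card (col (S - w x ` {a..<a + j}))"
      using a(3) by simp
    also have "\<dots> \<le> card (col S)" using growth[OF x a(1,2)] .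
    finally have "real (3 ^ (j - 1) * card (?B x j)) \<le> real (card (col S))"
      using of_nat_le_iff by blast
    then show ?thesis by (simp add: field_simps)
  qed
  have "(\<Sum>x\<in>through e S j. real (card (?B x j))) \<le> N j / 3 ^ (j - 1) * card (col S)"
    if "j \<in> ?J" for j
  proof -
    have "(\<Sum>x\<in>through e S j. real (card (?B x j))) \<le> card (through e S j) * (card (col S) / 3 ^ (j - 1))"
      using B by (intro sum_bounded_above) auto
    also have "\<dots> \<le> N j * (card (col S) / 3 ^ (j - 1))"
      using N[of j] that by (intro mult_right_mono) auto
    finally show ?thesis by simp
  qed
  then have "(\<Sum>j\<in>?J. \<Sum>x\<in>through e S j. real (card (?B x j)))
      \<le> (\<Sum>j\<in>?J. N j / 3 ^ (j - 1)) * card (col S)"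
    unfolding sum_distrib_right by (rule sum_mono)
  moreover have "real (card ?X) \<le>
      card (col (insert e S)) + (\<Sum>j\<in>?J. \<Sum>x\<in>through e S j. real (card (?B x j)))"
    using of_nat_mono[OF le, where 'a = real] by simp
  moreover have "real (card ?X) = 9 * card (col S)"
    using card_extensions[OF S e] by simp
  ultimately show ?thesis by linarith
qed

text \<open>A path minus its edge \<open>w x t\<close> is put back from its two ends towards \<open>w x t\<close>: each
  new edge then still has a facial neighbour that is not coloured.\<close>

lemma growth_chain:
  assumes grow: "\<And>e T g. insert e T \<subseteq> S \<Longrightarrow> e \<notin> T \<Longrightarrow> adj e g \<Longrightarrow> g \<notin> insert e T \<Longrightarrow>
      3 * card (col T) \<le> card (col (insert e T))"
    and P: "P x n" and sub: "w x ` {..<n} \<subseteq> insert (w x t) S" and t: "w x t \<notin> S"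
    and ab: "a \<le> t" "t < b" "b \<le> n"
  shows "3 ^ (b - a - 1) * card (col (S - w x ` {a..<b})) \<le> card (col S)"
proof -
  have xD: "x \<in> D" using path_D P .
  have inj: "w x i = w x k \<longleftrightarrow> i = k" if "i < n" "k < n" for i k
    using w_inj[OF P] that by (auto dest: inj_onD)
  have inS: "w x i \<in> S" if "i < n" "i \<noteq> t" for i
    using sub inj[of i t] that ab by auto
  \<comment> \<open>The induction removes edges leftwards from position \<open>t\<close>. Read
    backwards, \<open>w x (t - Suc m)\<close> is put back while its neighbour
    \<open>w x (t - m)\<close> is still missing.\<close>
  have left: "3 ^ m * card (col (S - w x ` {t - m..<Suc t})) \<le> card (col S)" if "m \<le> t" for m
    using that
  proof (induction m)
    case 0
    then show ?case using t by simp
  next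
    case (Suc m)
    let ?e = "w x (t - Suc m)" and ?T = "S - w x ` {t - Suc m..<Suc t}"
    have s: "{t - Suc m..<Suc t} = insert (t - Suc m) {t - m..<Suc t}" using Suc.prems by auto
    have "?e \<notin> w x ` {t - m..<Suc t}"
    proof
      assume "?e \<in> w x ` {t - m..<Suc t}"
      then obtain i where "i \<in> {t - m..<Suc t}" "?e = w x i" by auto
      then show False using inj[of "t - Suc m" i] Suc.prems ab by auto
    qed
    moreover have "?e \<in> S" using inS[of "t - Suc m"] Suc.prems ab by auto
    ultimately have ins: "insert ?e ?T = S - w x ` {t - m..<Suc t}" unfolding s by auto
    have "adj ?e (w x (t - m))"
      using adj_w(1)[OF xD, of "t - Suc m"] Suc.prems by (simp add: Suc_diff_Suc)
    moreover have "w x (t - m) \<notin> insert ?e ?T" unfolding ins by auto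
    moreover have "?e \<notin> ?T" using Suc.prems by auto
    ultimately have "3 * card (col ?T) \<le> card (col (S - w x ` {t - m..<Suc t}))"
      using grow[of ?e ?T "w x (t - m)"] ins by auto
    then have "3 ^ m * (3 * card (col ?T)) \<le> 3 ^ m * card (col (S - w x ` {t - m..<Suc t}))"
      by simp
    also have "\<dots> \<le> card (col S)" using Suc by simp
    finally show ?case by (simp add: mult_ac)
  qed
  \<comment> \<open>With the positions from \<open>a\<close> to \<open>t\<close> already removed,
    the same argument runs to the right, and the factors multiply.\<close>
  have right: "3 ^ (m + (t - a)) * card (col (S - w x ` {a..<Suc t + m})) \<le> card (col S)"
    if "Suc t + m \<le> n" for m
    using that
  proof (induction m)
    case 0
    then show ?case using left[of "t - a"] ab by simp
  next
    case (Suc m)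
    let ?e = "w x (Suc t + m)" and ?T = "S - w x ` {a..<Suc t + Suc m}"
    have s: "{a..<Suc t + Suc m} = insert (Suc t + m) {a..<Suc t + m}" using ab by auto
    have "?e \<notin> w x ` {a..<Suc t + m}"
    proof
      assume "?e \<in> w x ` {a..<Suc t + m}"
      then obtain i where "i \<in> {a..<Suc t + m}" "?e = w x i" by auto
      then show False using inj[of "Suc t + m" i] Suc.prems by auto
    qed
    moreover have "?e \<in> S" using inS[of "Suc t + m"] Suc.prems by auto
    ultimately have ins: "insert ?e ?T = S - w x ` {a..<Suc t + m}" unfolding s by auto
    have "adj ?e (w x (t + m))" using adj_w(2)[OF xD, of "t + m"] by simp
    moreover have "w x (t + m) \<notin> insert ?e ?T" unfolding ins using ab by auto
    moreover have "?e \<notin> ?T" using ab by auto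
    ultimately have "3 * card (col ?T) \<le> card (col (S - w x ` {a..<Suc t + m}))"
      using grow[of ?e ?T "w x (t + m)"] ins by auto
    then have "3 ^ (m + (t - a)) * (3 * card (col ?T))
        \<le> 3 ^ (m + (t - a)) * card (col (S - w x ` {a..<Suc t + m}))"
      by simp
    also have "\<dots> \<le> card (col S)" using Suc by simp
    finally show ?case by (simp add: mult_ac)
  qed
  \<comment> \<open>Of the \<open>b - a\<close> positions removed, \<open>t\<close> gives no factor
    3, since \<open>w x t\<close> is not in \<open>S\<close>.\<close>
  have "b - Suc t + (t - a) = b - a - 1" "Suc t + (b - Suc t) = b" using ab by auto
  then show ?thesis using right[of "b - Suc t"] ab by simp
qed

section \<open>Number of facial paths through an edge\<close>

text \<open>Since \<open>f ^^ t\<close> is injective, a path is recovered from the dart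
  \<open>y\<close> over \<open>e\<close> that it uses and the position \<open>t\<close> of that
  dart. \<open>T y\<close> collects the positions possible for \<open>y\<close>.\<close>

lemma card_through_le:
  assumes "\<And>x t. x \<in> through e S j \<Longrightarrow> t < 2 * j \<Longrightarrow> w x t = e \<Longrightarrow> t \<in> T ((f ^^ t) x)"
    and "\<And>y. finite (T y)"
  shows "card (through e S j) \<le> (\<Sum>y\<in>{y \<in> D. ed y = e}. card (T y))"
proof -
  let ?F = "{y \<in> D. ed y = e}"
  have "through e S j \<subseteq> (\<lambda>(y, t). THE x. (f ^^ t) x = y) ` (SIGMA y:?F. T y)"
  proof
    fix x assume x: "x \<in> through e S j"
    then obtain t where t: "t < 2 * j" "w x t = e" by (auto simp: through_def)
    have "x \<in> D" using x path_D by (auto simp: through_def)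
    then have "(f ^^ t) x \<in> ?F" using t iter_in by (simp add: w_def)
    moreover have "(THE z. (f ^^ t) z = (f ^^ t) x) = x" by (rule the_equality) (auto dest: iter_inj)
    ultimately show "x \<in> (\<lambda>(y, t). THE x. (f ^^ t) x = y) ` (SIGMA y:?F. T y)"
      using assms(1)[OF x t] by (intro image_eqI[where x = "((f ^^ t) x, t)"]) auto
  qed
  then have "card (through e S j) \<le> card (SIGMA y:?F. T y)"
    using fin_D assms(2) by (intro surj_card_le) auto
  then show ?thesis using fin_D assms(2) by (simp add: card_SigmaI)
qed

lemma card_through: "card (through e S j) \<le> 4 * j"
proof -
  have "card (through e S j) \<le> (\<Sum>y\<in>{y \<in> D. ed y = e}. card {..<2 * j})"
    by (rule card_through_le) auto
  also have "\<dots> = card {y \<in> D. ed y = e} * (2 * j)" by simp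
  also have "\<dots> \<le> 2 * (2 * j)" using fibre by (rule mult_right_mono) simp
  finally show ?thesis by simp
qed

text \<open>On the side where \<open>e\<close> borders the uncoloured \<open>g\<close>, it must be an end of the path.\<close>

lemma card_through_adj:
  assumes "adj e g" "g \<notin> insert e S"
  shows "card (through e S j) \<le> 2 * j + 1"
proof -
  let ?F = "{y \<in> D. ed y = e}"
  \<comment> \<open>\<open>y0\<close> is a dart over \<open>e\<close> next to one over
    \<open>g\<close> on the walk. \<open>s\<close> is the last position if \<open>g\<close> follows
    and the first one if \<open>g\<close> precedes.\<close>
  obtain y0 s where y0: "y0 \<in> ?F"
    and s: "\<And>x t. x \<in> through e S j \<Longrightarrow> t < 2 * j \<Longrightarrow> (f ^^ t) x = y0 \<Longrightarrow> t = s"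
  proof -
    obtain z where z: "z \<in> D" and "ed z = e \<and> ed (f z) = g \<or> ed z = g \<and> ed (f z) = e"
      using assms(1) by (auto simp: adj_def)
    then consider "ed z = e" "ed (f z) = g" | "ed z = g" "ed (f z) = e" by blast
    then show thesis
    proof cases
      case 1
      have "t = 2 * j - 1" if x: "x \<in> through e S j" "t < 2 * j" "(f ^^ t) x = z" for x t
      proof (rule ccontr)
        assume "t \<noteq> 2 * j - 1"
        then have "Suc t < 2 * j" using x(2) by simp
        then have "w x (Suc t) \<in> insert e S" using x(1) by (force simp: through_def)
        then show False using x(3) 1 assms(2) by (simp add: w_def)
      qed
      then show thesis using that[of z "2 * j - 1"] z 1 by blast
    next
      case 2
      have "t = 0" if x: "x \<in> through e S j" "t < 2 * j" "(f ^^ t) x = f z" for x t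
      proof (rule ccontr)
        assume "t \<noteq> 0"
        then obtain u where u: "t = Suc u" by (cases t) auto
        then have "(f ^^ u) x = z" using x(3) permutes_inj[OF perm] by (auto dest: injD)
        moreover have "w x u \<in> insert e S" using x(1,2) unfolding u through_def
          by (auto simp: image_subset_iff)
        ultimately show False using 2 assms(2) by (simp add: w_def)
      qed
      then show thesis using that[of "f z" 0] z 2 permutes_in_image[OF perm] by blast
    qed
  qed
  \<comment> \<open>One position for \<open>y0\<close>, and up to \<open>2 * j\<close> for the other
    dart over \<open>e\<close>, if there is one.\<close>
  let ?T = "\<lambda>y. if y = y0 then {s} else {..<2 * j}"
  have "card (through e S j) \<le> (\<Sum>y\<in>?F. card (?T y))"
    by (rule card_through_le) (use s in auto)
  also have "\<dots> = 1 + (\<Sum>y\<in>?F - {y0}. card (?T y))"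
    using y0 fin_D by (subst sum.remove[of _ y0]) auto
  also have "(\<Sum>y\<in>?F - {y0}. card (?T y)) = (\<Sum>y\<in>?F - {y0}. 2 * j)"
    by (rule sum.cong) auto
  also have "\<dots> = card (?F - {y0}) * (2 * j)" by simp
  also have "\<dots> \<le> 1 * (2 * j)"
    using y0 fin_D fibre[of e] by (intro mult_right_mono) (auto simp: card_Diff_singleton)
  finally show ?thesis by simp
qed

section \<open>Growth of the number of colourings\<close>

text \<open>Strong induction on \<open>card S\<close>: putting edges back invokes growth only for
  proper subsets \<open>T\<close> of \<open>S\<close>. The repetitions through \<open>e\<close> then
  spoil at most \<open>6 * card (col S)\<close> of the \<open>9 * card (col S)\<close>
  extensions.\<close>

lemma growth:
  assumes "insert e S \<subseteq> ed ` D" "e \<notin> S" "adj e g" "g \<notin> insert e S"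
  shows "3 * card (col S) \<le> card (col (insert e S))"
  using assms
proof (induction "card S" arbitrary: S e g rule: less_induct)
  case less
  note S = less.prems(1) and e = less.prems(2)
  have finS: "finite S" using S fin_edges by simp
  have grow: "3 * card (col T) \<le> card (col (insert e' T))"
    if "insert e' T \<subseteq> S" "e' \<notin> T" "adj e' h" "h \<notin> insert e' T" for e' T h
  proof -
    have "card T < card S" using that finS by (intro psubset_card_mono) auto
    then show ?thesis using less.hyps[of T e' h] that S by auto
  qed
  let ?N = "\<lambda>j::nat. 2 * real j + 1"
  let ?s = "\<Sum>j=1..Suc (card S). ?N j / 3 ^ (j - 1)"
  have "9 * card (col S) \<le> card (col (insert e S)) + ?s * card (col S)"
  proof (rule extension_count[OF S e])
    fix x j a
    assume x: "x \<in> through e S j" "a + j \<le> 2 * j" "e \<in> w x ` {a..<a + j}"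
    then obtain t where t: "t \<in> {a..<a + j}" "e = w x t" by auto
    show "3 ^ (j - 1) * card (col (S - w x ` {a..<a + j})) \<le> card (col S)"
      using growth_chain[of S x "2 * j" t a "a + j", OF grow] x t e
        by (auto simp: through_def)
  next
    fix j :: nat assume "1 \<le> j"
    show "real (card (through e S j)) \<le> ?N j"
      using of_nat_mono[OF card_through_adj[OF less.prems(3,4), of j], where 'a = real] by simp
  qed
  moreover have "?s \<le> 6"
    unfolding sum_arith_geom[of 2 1] by (simp add: field_simps)
  then have "?s * card (col S) \<le> 6 * real (card (col S))" by (rule mult_right_mono) simp
  ultimately have "3 * real (card (col S)) \<le> card (col (insert e S))" by linarith
  then show ?case by linarith
qed

text \<open>Edges are added one at a time. The new edge may have no uncoloured neighbour, so its
  paths are bounded by \<open>4 * j\<close>, which still preserves positivity.\<close>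

lemma col_nonempty:
  assumes "S \<subseteq> ed ` D"
  shows "col S \<noteq> {}"
proof -
  have "finite S" using assms fin_edges by simp
  then show ?thesis using assms
  proof (induction S)
    case empty
    have "j = 0" if "w x ` {..<2 * j} \<subseteq> {}" for x j
      using that by (simp add: lessThan_empty_iff)
    then have "(\<lambda>_. undefined) \<in> col {}" by (force simp: col_def)
    then show ?case by blast
  next
    case (insert e S)
    note S = insert.prems and e = insert.hyps(2)
    have grow: "3 * card (col T) \<le> card (col (insert e' T))"
      if "insert e' T \<subseteq> S" "e' \<notin> T" "adj e' h" "h \<notin> insert e' T" for e' T h
      using growth[of e' T h] that S by auto
    \<comment> \<open>The summand \<open>+ 0\<close> gives the shape of
      \<open>sum_arith_geom\<close> with \<open>q = 0\<close>.\<close>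
    let ?s = "\<Sum>j=1..Suc (card S). (4 * real j + 0) / 3 ^ (j - 1)"
    have "9 * card (col S) \<le> card (col (insert e S)) + ?s * card (col S)"
    proof (rule extension_count[OF S e])
      fix x j a
      assume x: "x \<in> through e S j" "a + j \<le> 2 * j" "e \<in> w x ` {a..<a + j}"
      then obtain t where t: "t \<in> {a..<a + j}" "e = w x t" by auto
      show "3 ^ (j - 1) * card (col (S - w x ` {a..<a + j})) \<le> card (col S)"
        using growth_chain[of S x "2 * j" t a "a + j", OF grow] x t e
        by (auto simp: through_def)
    next
      fix j :: nat assume "1 \<le> j"
      show "real (card (through e S j)) \<le> 4 * real j + 0"
        using of_nat_mono[OF card_through[of e S j], where 'a = real] by simp
    qed
    \<comment> \<open>The infinite series equals 9, so strictness comes from the tail that the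
      finite sum omits.\<close>
    moreover have "?s < 9"
      unfolding sum_arith_geom[of 4 0] by (simp add: field_simps)
    moreover have "0 < card (col S)"
      using insert finite_col by (simp add: card_gt_0_iff)
    ultimately have "0 < real (card (col (insert e S)))"
      using mult_strict_right_mono[of ?s 9 "real (card (col S))"] by linarith
    then show ?case by (metis card.empty of_nat_0 less_irrefl)
  qed
qed

end

section \<open>From plane maps to facial walks\<close>

text \<open>An edge met at two positions is traversed either by the same dart, which repeats a start
  vertex, or by opposite darts, which forces both \<open>i' = Suc i\<close> and
  \<open>i = Suc i'\<close>.\<close>

lemma facial_path_edges_inj:
  assumes sp: "simple_plane_map D alpha sigma" and P: "facial_path D alpha sigma x k"
  shows "inj_on (path_edge alpha sigma x) {..<k}"
proof -
  let ?v = "\<lambda>i. orb sigma ((phi alpha sigma ^^ i) x)"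
  have D: "finite D" "sigma permutes D" "alpha permutes D" "\<forall>d\<in>D. alpha (alpha d) = d"
    using sp by (auto simp: simple_plane_map_def)
  have inD: "(phi alpha sigma ^^ i) x \<in> D" for i
    using P D(2,3) by (induction i) (simp_all add: facial_path_def phi_def permutes_in_image)
  \<comment> \<open>\<open>orb\<close> has only forward iterates, so returning from
    \<open>sigma d\<close> to \<open>d\<close> takes a positive power of \<open>sigma\<close> that
    fixes \<open>d\<close>.\<close>
  have orb_sigma: "orb sigma (sigma d) = orb sigma d" for d
  proof -
    obtain n where n: "n > 0" "(sigma ^^ n) d = d"
      using permutation_self D(1,2) permutation_permutes by metis
    have "(sigma ^^ i) d \<in> orb sigma (sigma d)" for i
    proof (cases i)
      case 0
      have "(sigma ^^ (n - 1)) (sigma d) = (sigma ^^ n) d"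
        using n(1) by (metis Suc_diff_1 comp_apply funpow_Suc_right)
      then show ?thesis unfolding orb_def using 0 n(2) by (auto intro!: exI[of _ "n - 1"])
    next
      case (Suc m)
      then show ?thesis unfolding orb_def by (auto simp: funpow_swap1)
    qed
    moreover have "(sigma ^^ i) (sigma d) \<in> orb sigma d" for i
      unfolding orb_def by (auto simp: funpow_swap1 intro: exI[of _ "Suc i"])
    ultimately show ?thesis unfolding orb_def by blast
  qed
  \<comment> \<open>\<open>alpha\<close> passes to the other end of the edge and
    \<open>sigma\<close> turns around that vertex, so one dart ends where the next one
    starts.\<close>
  have v_Suc: "orb sigma (alpha ((phi alpha sigma ^^ i) x)) = ?v (Suc i)" for i
    by (simp add: phi_def orb_sigma)
  have v_inj: "i = i'" if "?v i = ?v i'" "i \<le> k" "i' \<le> k" for i i'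
    using P that by (auto simp: facial_path_def dest: inj_onD)
  show ?thesis
  proof (rule inj_onI, rule ccontr)
    fix i i' assume i: "i \<in> {..<k}" "i' \<in> {..<k}" "i \<noteq> i'"
      and "path_edge alpha sigma x i = path_edge alpha sigma x i'"
    then consider "(phi alpha sigma ^^ i) x = (phi alpha sigma ^^ i') x"
      | "(phi alpha sigma ^^ i') x = alpha ((phi alpha sigma ^^ i) x)"
        "(phi alpha sigma ^^ i) x = alpha ((phi alpha sigma ^^ i') x)"
      unfolding path_edge_def edge_of_def by (metis doubleton_eq_iff)
    then show False
    proof cases
      case 1
      then show False using v_inj[of i i'] i by simp
    next
      case 2
      have "?v i' = ?v (Suc i)" "?v i = ?v (Suc i')"
        using v_Suc[of i] v_Suc[of i'] 2 by argo+
      then show False using v_inj[of i' "Suc i"] v_inj[of i "Suc i'"] i by auto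
    qed
  qed
qed

theorem theorem8:
  fixes D :: "'d set" and alpha sigma :: "'d \<Rightarrow> 'd"
    and estar :: "'d set" and L :: "'d set \<Rightarrow> 'c set"
  assumes "simple_plane_map D alpha sigma"
    and "estar \<in> map_edges D alpha"
    and "\<forall>e \<in> map_edges D alpha. finite (L e) \<and> card (L e) = 9"
  shows "\<exists>c :: 'd set \<Rightarrow> 'c option.
           (\<forall>e \<in> map_edges D alpha. e \<noteq> estar \<longrightarrow> (\<exists>x \<in> L e. c e = Some x)) \<and>
           c estar = None \<and>
           facial_thue D alpha sigma c"
proof -
  interpret facial_walks D "phi alpha sigma" "edge_of alpha" "facial_path D alpha sigma" L
  proof
    show "finite D" using assms(1) by (simp add: simple_plane_map_def)
    show "phi alpha sigma permutes D"
      using assms(1) by (auto simp: simple_plane_map_def phi_def intro: permutes_compose)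
    show "card {x \<in> D. edge_of alpha x = e} \<le> 2" for e
    proof (cases "\<exists>y. edge_of alpha y = e")
      case True
      then obtain y where "edge_of alpha y = e" by blast
      then have "{x \<in> D. edge_of alpha x = e} \<subseteq> {y, alpha y}"
        by (auto simp: edge_of_def)
      then have "card {x \<in> D. edge_of alpha x = e} \<le> card {y, alpha y}"
        by (intro card_mono) auto
      also have "\<dots> \<le> 2" by (simp add: card_insert_if)
      finally show ?thesis .
    qed simp
    show "x \<in> D" if "facial_path D alpha sigma x k" for x k
      using that by (simp add: facial_path_def)
    show "inj_on (\<lambda>i. edge_of alpha ((phi alpha sigma ^^ i) x)) {..<k}"
      if "facial_path D alpha sigma x k" for x k
      using facial_path_edges_inj[OF assms(1) that] by (simp add: path_edge_def[abs_def])
    show "finite (L (edge_of alpha x)) \<and> card (L (edge_of alpha x)) = 9" if "x \<in> D" for x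
      using assms(3) that by (simp add: map_edges_def)
  qed
  let ?S = "map_edges D alpha - {estar}"
  obtain c where c: "c \<in> col ?S"
    using col_nonempty[of ?S] by (auto simp: map_edges_def)
  \<comment> \<open>With \<open>None\<close> outside \<open>?S\<close>, a path whose edges are all
    coloured lies in \<open>?S\<close>, where \<open>col\<close> excludes repetitions.\<close>
  let ?c = "\<lambda>e. if e \<in> ?S then Some (c e) else None"
  have w: "w = path_edge alpha sigma" by (simp add: fun_eq_iff w_def path_edge_def)
  have "facial_thue D alpha sigma ?c"
    unfolding facial_thue_def
  proof (intro allI impI notI)
    fix x and j :: nat
    assume x: "1 \<le> j \<and> facial_path D alpha sigma x (2 * j) \<and>
        (\<forall>i < 2 * j. ?c (path_edge alpha sigma x i) \<noteq> None)"
      and r: "\<forall>i < j. ?c (path_edge alpha sigma x i) = ?c (path_edge alpha sigma x (i + j))"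
    have sub: "w x i \<in> ?S" if "i < 2 * j" for i
      using x that unfolding w by (metis (full_types))
    then have "rep c x j"
      unfolding rep_def
    proof (intro allI impI)
      fix i assume "i < j"
      then show "c (w x i) = c (w x (i + j))"
        using sub[of i] sub[of "i + j"] r[folded w, rule_format, of i] by simp
    qed
    then show False using c x sub unfolding col_def by blast
  qed
  moreover have "\<forall>e \<in> map_edges D alpha. e \<noteq> estar \<longrightarrow> (\<exists>x \<in> L e. ?c e = Some x)"
    using c by (auto simp: col_def)
  ultimately show ?thesis by (intro exI[of _ ?c]) auto
qed

end
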